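(* Let $a,b_1,b_2,\mu,m,s,F,c$ be real parameters with $b_1>0$, $b_2>0$, $\mu>0$, $m\ge 0$, $F\ge 0$, $c\ge 0$, $0\le s<1$. Put $$x=\max\left\{\frac{1}{1-s},\ \frac{b_1c}{b_2}\right\},\qquad l^*=\frac{\ln x}{\mu},$$ and assume that $\dfrac{a-b_2l^*}{b_1}\ge m$ and $a\mu-\mu b_2l^*-\mu mb_1-Fb_1-cb_1e^{-\mu l^*}\ge 0$. Consider the optimization problem (P2): maximize $$\bar\lambda\,(p-m)-\frac{F\lambda}{\mu+\lambda}-\frac{c\bar\lambda}{\mu}e^{-\mu l}$$ over real $(\lambda,p,l,\bar\lambda)$ subject to $$\lambda\le a-b_1p-b_2l,\qquad 1-e^{-\mu l}\ge s,\qquad \rho=\frac{\lambda}{\mu},\qquad P_1=\frac{\rho}{1+\rho},\qquad \bar\lambda=\lambda(1-P_1),\qquad \lambda,p,l,\bar\lambda\ge 0.$$ Then the maximum is attained at the lead-time $l^*$ together with the demand and price $$\lambda^*=-\mu+\sqrt{\mu^2+a\mu-\mu b_2l^*-\mu b_1m-Fb_1-b_1ce^{-\mu l^*}},\qquad p^*=\frac{a-b_2l^*-\lambda^*}{b_1}$$ (with $\bar\lambda$ determined by $\lambda^*$ through the equality constraints), and the maximal value of the objective is $$\frac{\lambda^*\left(p^*\mu-m\mu-F-ce^{-\mu l^*}\right)}{\mu+\lambda^*}.$$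
   Context: The problem (P2) models a make-to-order firm as an M/M/1/1 queue (an arriving customer is rejected if one customer is already in the system) with holding and lateness penalty costs. Decision variables: $p$ is the price, $l$ the quoted lead-time, $\lambda$ the mean arrival rate (demand), $\bar\lambda$ the throughput rate (effective demand). Parameters: $a$ is the market potential, $b_1$ the price sensitivity and $b_2$ the lead-time sensitivity of demand, $\mu$ the mean service rate, $m$ the unit direct variable cost, $s$ the required service level, $F$ the unit holding cost, $c$ the penalty cost per job per unit lateness. $P_1$ is the probability that a customer is rejected. The constraint $1-e^{-\mu l}\ge s$ expresses that the probability that the actual lead-time is at most $l$ is at least $s$. *)

theory Defs
  imports Complex_Main
begin

definition traffic_intensity :: "real \<Rightarrow> real \<Rightarrow> real" where
  "traffic_intensity \<mu> lam = lam / \<mu>"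

definition rejection_prob :: "real \<Rightarrow> real \<Rightarrow> real" where
  "rejection_prob \<mu> lam =
     traffic_intensity \<mu> lam / (1 + traffic_intensity \<mu> lam)"

text \<open>
  A decision is a tuple (demand rate, price, quoted lead-time, throughput).
  The traffic intensity and the rejection probability of the M/M/1/1 queue are
  functions of the demand rate, so their defining equality constraints are
  substituted into the throughput constraint.
\<close>

definition feasible ::
  "real \<Rightarrow> real \<Rightarrow> real \<Rightarrow> real \<Rightarrow> real \<Rightarrow> (real \<times> real \<times> real \<times> real) set" where
  "feasible a b\<^sub>1 b\<^sub>2 \<mu> s =
     {(lam, p, l, lam_bar).
        lam \<le> a - b\<^sub>1 * p - b\<^sub>2 * l \<and>
        1 - exp (- \<mu> * l) \<ge> s \<and>
        lam_bar = lam * (1 - rejection_prob \<mu> lam) \<and>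
        lam \<ge> 0 \<and> p \<ge> 0 \<and> l \<ge> 0 \<and> lam_bar \<ge> 0}"

fun profit ::
  "real \<Rightarrow> real \<Rightarrow> real \<Rightarrow> real \<Rightarrow> real \<times> real \<times> real \<times> real \<Rightarrow> real" where
  "profit \<mu> m F c (lam, p, l, lam_bar) =
     lam_bar * (p - m) - F * lam / (\<mu> + lam) - c * lam_bar / \<mu> * exp (- \<mu> * l)"

end

theory Submission
  imports Defs
begin

text \<open>
  At fixed lead-time the price constraint binds, and in the variable $t = \mu + \lambda$ the
  profit becomes $(N^2 + \mu^2 - \mu t - \mu N^2 / t) / b_1$, which falls short of its value at
  $t = N$ by $\mu (t - N)^2 / (b_1 t)$. Here $N^2 - \mu^2$ depends on the lead-time only through
  the cost $b_2 y + b_1 c e^{-y}$ with $y = \mu l$; this is convex with stationary point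
  $e^y = b_1 c / b_2$, so on $e^y \ge 1 / (1 - s)$ its minimum is at $y = \ln x$.
\<close>

text \<open>The tangent to \<open>k * exp (- y)\<close> at \<open>ln x\<close> lies below the curve,
  so the cost difference is at least \<open>(b - k / x) * (y - ln x)\<close>. No derivatives are
  needed.\<close>

lemma lead_time_cost_minimal:
  fixes b k r x y :: real
  assumes "b > 0" "k \<ge> 0" "r > 0" and x: "x = max r (k / b)" and y: "ln r \<le> y"
  shows "b * ln x + k * exp (- ln x) \<le> b * y + k * exp (- y)"
proof -
  have x0: "x > 0" using assms by (simp add: less_max_iff_disj)
  have "k / b \<le> x" using x by simp
  then have slope: "k / x \<le> b"
    using x0 \<open>b > 0\<close> by (simp add: field_simps)
  \<comment> \<open>Complementary slackness: either the lower bound \<open>ln r\<close> is active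
    and both factors are nonnegative, or \<open>x = k / b\<close> and the slope at
    \<open>ln x\<close> vanishes.\<close>
  have sign: "0 \<le> (b - k / x) * (y - ln x)"
  proof (cases "x = r")
    case True
    then show ?thesis using slope y by simp
  next
    case False
    then have "x = k / b" using x by (auto simp: max_def split: if_splits)
    then have "b - k / x = 0" using x0 \<open>b > 0\<close> by (auto simp: field_simps)
    then show ?thesis by simp
  qed
  have "1 + (ln x - y) \<le> exp (ln x - y)" by (rule exp_ge_add_one_self)
  then have "(k / x) * (1 + (ln x - y)) \<le> (k / x) * exp (ln x - y)"
    using x0 \<open>k \<ge> 0\<close> by (intro mult_left_mono) auto
  also have "\<dots> = k * exp (- y)"
    using x0 by (simp add: exp_diff exp_minus field_simps)
  finally have "k / x + (k / x) * (ln x - y) \<le> k * exp (- y)"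
    by (simp add: distrib_left)
  moreover have "k * exp (- ln x) = k / x"
    using x0 by (simp add: exp_minus field_simps)
  ultimately show ?thesis using sign by (simp add: algebra_simps)
qed

lemma throughput:
  assumes "\<mu> > 0" "lam \<ge> 0"
  shows "lam * (1 - rejection_prob \<mu> lam) = lam * \<mu> / (\<mu> + lam)"
proof -
  have "\<mu> + lam > 0" using assms by simp
  then show ?thesis
    using assms by (simp add: rejection_prob_def traffic_intensity_def divide_simps)
qed

lemma profit_throughput:
  assumes "\<mu> > 0" "lam \<ge> 0"
  shows "profit \<mu> m F c (lam, p, l, lam * (1 - rejection_prob \<mu> lam)) =
    lam * (p * \<mu> - m * \<mu> - F - c * exp (- \<mu> * l)) / (\<mu> + lam)"
  unfolding profit.simps throughput[OF assms]
  using assms by (simp add: divide_simps) (simp add: algebra_simps)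

text \<open>With \<open>t = \<mu> + lam\<close> the subtracted numerator is
  \<open>(t - \<mu>) * (N\<^sup>2 - \<mu> * t)\<close>, so clearing the denominator leaves a perfect
  square. The identity serves twice: as an equality at \<open>t = N\<close> and as an upper bound
  elsewhere.\<close>

lemma demand_revenue_gap:
  fixes \<mu> lam D N :: real
  assumes "\<mu> + lam > 0" and N: "N\<^sup>2 = \<mu>\<^sup>2 + D"
  shows "(N - \<mu>)\<^sup>2 - lam * (D - \<mu> * lam) / (\<mu> + lam) = \<mu> * (\<mu> + lam - N)\<^sup>2 / (\<mu> + lam)"
proof -
  have "D = N\<^sup>2 - \<mu>\<^sup>2" using N by simp
  then show ?thesis
    using assms(1) by (simp add: divide_simps) (simp add: algebra_simps power2_eq_square)
qed

theorem proposition4: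
  fixes a b\<^sub>1 b\<^sub>2 \<mu> m s F c x l_opt lam_opt p_opt lam_bar_opt :: real
  assumes "b\<^sub>1 > 0" and "b\<^sub>2 > 0" and "\<mu> > 0" and "m \<ge> 0" and "F \<ge> 0" and "c \<ge> 0"
    and "0 \<le> s" and "s < 1"
    and x: "x = max (1 / (1 - s)) (b\<^sub>1 * c / b\<^sub>2)"
    and l_opt: "l_opt = ln x / \<mu>"
    and "(a - b\<^sub>2 * l_opt) / b\<^sub>1 \<ge> m"
    and "a * \<mu> - \<mu> * b\<^sub>2 * l_opt - \<mu> * m * b\<^sub>1 - F * b\<^sub>1 - c * b\<^sub>1 * exp (- \<mu> * l_opt) \<ge> 0"
    and lam_opt: "lam_opt = - \<mu> + sqrt (\<mu>\<^sup>2 + a * \<mu> - \<mu> * b\<^sub>2 * l_opt - \<mu> * b\<^sub>1 * m - F * b\<^sub>1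
                                   - b\<^sub>1 * c * exp (- \<mu> * l_opt))"
    and p_opt: "p_opt = (a - b\<^sub>2 * l_opt - lam_opt) / b\<^sub>1"
    and lam_bar_opt: "lam_bar_opt = lam_opt * (1 - rejection_prob \<mu> lam_opt)"
  shows "is_arg_max (profit \<mu> m F c) (\<lambda>v. v \<in> feasible a b\<^sub>1 b\<^sub>2 \<mu> s)
           (lam_opt, p_opt, l_opt, lam_bar_opt) \<and>
         profit \<mu> m F c (lam_opt, p_opt, l_opt, lam_bar_opt) =
           lam_opt * (p_opt * \<mu> - m * \<mu> - F - c * exp (- \<mu> * l_opt)) / (\<mu> + lam_opt)"
proof -
  note pos = assms(1-8)
  define e where "e = exp (- \<mu> * l_opt)"
  \<comment> \<open>\<open>D\<close> is
    \<open>b\<^sub>1 * (p * \<mu> - m * \<mu> - F - c * e)\<close> for the price that makes demand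
    vanish at \<open>l_opt\<close>; each unit of demand then lowers it by
    \<open>\<mu>\<close>.\<close>
  define D where "D = a * \<mu> - \<mu> * b\<^sub>2 * l_opt - \<mu> * m * b\<^sub>1 - F * b\<^sub>1 - c * b\<^sub>1 * e"
  define N where "N = sqrt (\<mu>\<^sup>2 + D)"
  define A where "A = a - b\<^sub>2 * l_opt"
  have D0: "D \<ge> 0" using assms(12) by (simp add: D_def e_def)
  have N2: "N\<^sup>2 = \<mu>\<^sup>2 + D" using D0 by (simp add: N_def)
  have lam: "lam_opt = N - \<mu>"
    by (simp add: lam_opt N_def D_def e_def algebra_simps)
  have lam0: "lam_opt \<ge> 0"
    using D0 pos by (simp add: lam N_def real_le_rsqrt)
  have x1: "1 / (1 - s) \<le> x" using x by simp
  moreover have "1 \<le> 1 / (1 - s)" using pos by simp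
  ultimately have "x \<ge> 1" by linarith
  then have l0: "l_opt \<ge> 0" using pos by (simp add: l_opt)
  have mul: "\<mu> * l_opt = ln x" using pos by (simp add: l_opt)
  \<comment> \<open>The service level holds at \<open>l_opt\<close> because the maximum defining
    \<open>x\<close> includes \<open>1 / (1 - s)\<close>.\<close>
  have "e = 1 / x" using \<open>x \<ge> 1\<close> mul by (simp add: e_def exp_minus inverse_eq_divide)
  also have "\<dots> \<le> 1 - s" using x1 \<open>x \<ge> 1\<close> pos by (simp add: field_simps)
  finally have es: "1 - e \<ge> s" by simp
  have A0: "A \<ge> 0"
  proof -
    have "0 \<le> A / b\<^sub>1" using assms(11) pos by (simp add: A_def)
    then show ?thesis using pos by (simp add: zero_le_divide_iff)
  qed
  \<comment> \<open>This says \<open>lam_opt \<le> A\<close>, which is what a nonnegative price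
    requires.\<close>
  have "N \<le> \<mu> + A"
  proof (rule power2_le_imp_le)
    have "D \<le> \<mu> * A"
    proof -
      have "0 \<le> \<mu> * m * b\<^sub>1" "0 \<le> F * b\<^sub>1" "0 \<le> c * b\<^sub>1 * e" using pos by (simp_all add: e_def)
      then show ?thesis by (simp add: D_def A_def algebra_simps)
    qed
    moreover have "0 \<le> \<mu> * A" using pos A0 by simp
    moreover have "0 \<le> A\<^sup>2" by simp
    moreover have "(\<mu> + A)\<^sup>2 = \<mu>\<^sup>2 + 2 * (\<mu> * A) + A\<^sup>2" by (simp add: power2_sum)
    ultimately show "N\<^sup>2 \<le> (\<mu> + A)\<^sup>2"
      unfolding N2 by linarith
  qed (use pos A0 in simp)
  then have p0: "p_opt \<ge> 0" using pos by (simp add: p_opt lam A_def)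
  have feas: "(lam_opt, p_opt, l_opt, lam_bar_opt) \<in> feasible a b\<^sub>1 b\<^sub>2 \<mu> s"
    using lam0 l0 p0 es pos
    by (simp add: feasible_def lam_bar_opt throughput e_def p_opt)
  have val: "profit \<mu> m F c (lam_opt, p_opt, l_opt, lam_bar_opt) =
      lam_opt * (p_opt * \<mu> - m * \<mu> - F - c * e) / (\<mu> + lam_opt)"
    unfolding lam_bar_opt e_def using pos lam0 by (intro profit_throughput) auto
  have price: "b\<^sub>1 * (p_opt * \<mu> - m * \<mu> - F - c * e) = D - \<mu> * lam_opt"
  proof -
    have "b\<^sub>1 * p_opt = a - b\<^sub>2 * l_opt - lam_opt" using pos by (simp add: p_opt)
    then have "b\<^sub>1 * p_opt * \<mu> = (a - b\<^sub>2 * l_opt - lam_opt) * \<mu>" by simp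
    then show ?thesis by (simp add: D_def algebra_simps)
  qed
  \<comment> \<open>At \<open>lam_opt\<close> the denominator \<open>\<mu> + lam_opt\<close> equals
    \<open>N\<close>, so the square in the gap identity is zero.\<close>
  have value_N: "b\<^sub>1 * profit \<mu> m F c (lam_opt, p_opt, l_opt, lam_bar_opt) = (N - \<mu>)\<^sup>2"
  proof -
    have "\<mu> + lam_opt > 0" using pos lam0 by simp
    from demand_revenue_gap[OF this N2]
    have "(N - \<mu>)\<^sup>2 = lam_opt * (D - \<mu> * lam_opt) / (\<mu> + lam_opt)"
      by (simp add: lam)
    then show ?thesis unfolding val price[symmetric] by (simp add: ac_simps)
  qed
  have "profit \<mu> m F c v \<le> profit \<mu> m F c (lam_opt, p_opt, l_opt, lam_bar_opt)"
    if v: "v \<in> feasible a b\<^sub>1 b\<^sub>2 \<mu> s" for v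
  proof -
    obtain la p l lb where v_eq: "v = (la, p, l, lb)" by (cases v)
    have la: "la \<le> a - b\<^sub>1 * p - b\<^sub>2 * l" "la \<ge> 0" and l: "exp (- \<mu> * l) \<le> 1 - s"
      and lb: "lb = la * (1 - rejection_prob \<mu> la)"
      using v by (simp_all add: feasible_def v_eq)
    have t: "\<mu> + la > 0" using la pos by simp
    \<comment> \<open>The service constraint in logarithmic form is the hypothesis of the cost lemma
      with \<open>r = 1 / (1 - s)\<close>.\<close>
    have "ln (1 / (1 - s)) \<le> \<mu> * l"
    proof -
      have "- \<mu> * l \<le> ln (1 - s)" using l pos by (subst ln_ge_iff) auto
      then show ?thesis using pos by (simp add: ln_div)
    qed
    then have "b\<^sub>2 * ln x + b\<^sub>1 * c * exp (- ln x) \<le> b\<^sub>2 * (\<mu> * l) + b\<^sub>1 * c * exp (- (\<mu> * l))"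
      using pos x by (intro lead_time_cost_minimal) auto
    then have cost: "b\<^sub>2 * (\<mu> * l_opt) + b\<^sub>1 * c * e \<le> b\<^sub>2 * (\<mu> * l) + b\<^sub>1 * c * exp (- \<mu> * l)"
      by (simp add: mul e_def)
    \<comment> \<open>The demand constraint bounds the price term; the cost comparison then replaces
      \<open>l\<close> by \<open>l_opt\<close>, giving a bound in \<open>la\<close> alone.\<close>
    have "\<mu> * (la + b\<^sub>1 * p + b\<^sub>2 * l) \<le> \<mu> * a" using la pos by (intro mult_left_mono) auto
    then have "b\<^sub>1 * (p * \<mu> - m * \<mu> - F - c * exp (- \<mu> * l)) \<le> D - \<mu> * la"
      using cost by (simp add: D_def algebra_simps)
    then have "la * (b\<^sub>1 * (p * \<mu> - m * \<mu> - F - c * exp (- \<mu> * l))) / (\<mu> + la)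
        \<le> la * (D - \<mu> * la) / (\<mu> + la)"
      using la t by (intro divide_right_mono mult_left_mono) auto
    also have "\<dots> \<le> (N - \<mu>)\<^sup>2"
    proof -
      have "0 \<le> \<mu> * (\<mu> + la - N)\<^sup>2 / (\<mu> + la)" using pos t by simp
      then show ?thesis using demand_revenue_gap[OF t N2] by linarith
    qed
    also have "\<dots> = b\<^sub>1 * profit \<mu> m F c (lam_opt, p_opt, l_opt, lam_bar_opt)"
      by (rule value_N[symmetric])
    finally have "b\<^sub>1 * profit \<mu> m F c v
        \<le> b\<^sub>1 * profit \<mu> m F c (lam_opt, p_opt, l_opt, lam_bar_opt)"
      unfolding v_eq lb using la pos by (subst profit_throughput) (auto simp: ac_simps)
    then show ?thesis using pos by simp
  qed
  then show ?thesis
    using feas val by (auto simp: is_arg_max_def e_def not_less)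
qed

end
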